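(* For every graph $H$, $c(H,H)=c(H)$.
   Context: For graphs $H$ and $G$, $t(H,G)=\hom(H,G)/v(G)^{v(H)}$ is the probability that a uniformly random map $V(H)\to V(G)$ is a homomorphism (maps edges to edges). Let $G_1,G_2,\dots$ be a sequence containing every finite graph exactly once, and $\overline{G}$ denotes the complement of $G$. For graphs $H_1,H_2$ and $\lambda\in[0,2]$, $c_\lambda(H_1,H_2):=\liminf_{n\to\infty}\left[\lambda\, t(H_1,G_n)+(2-\lambda)\, t(H_2,\overline{G_n})\right]$, and the balanced Ramsey multiplicity constant is $c(H_1,H_2):=\sup_{\lambda\in[0,2]}c_\lambda(H_1,H_2)$. The Ramsey multiplicity constant of $H$ is $c(H):=\liminf_{n\to\infty}\left[t(H,G_n)+t(H,\overline{G_n})\right]$. *)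

theory Defs
  imports
    "Graph_Theory.Pair_Digraph"
    "Graph_Theory.Digraph_Isomorphism"
    "HOL-Library.Countable_Set"
    "HOL-Library.Extended_Real"
    "HOL-Library.FuncSet"
begin

text \<open>
  A finite simple graph is a \<^const>\<open>pair_graph\<close>: an edge \<open>uv\<close> is represented by the two
  arcs \<open>(u, v)\<close> and \<open>(v, u)\<close>.
\<close>

definition graph_homs :: "'a pair_pre_digraph \<Rightarrow> 'b pair_pre_digraph \<Rightarrow> ('a \<Rightarrow> 'b) set" where
  "graph_homs H G =
     {f \<in> pverts H \<rightarrow>\<^sub>E pverts G. \<forall>(u, v) \<in> parcs H. (f u, f v) \<in> parcs G}"

text \<open>
  If \<open>G\<close> has no vertices and \<open>H\<close> has some, the density is \<open>0 / 0 = 0\<close>.  Only one graph \<open>G\<close>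
  up to isomorphism is concerned, so this does not affect the limits below.
\<close>

definition hom_density :: "'a pair_pre_digraph \<Rightarrow> 'b pair_pre_digraph \<Rightarrow> real" where
  "hom_density H G = real (card (graph_homs H G)) / real (card (pverts G)) ^ card (pverts H)"

definition graph_complement :: "'a pair_pre_digraph \<Rightarrow> 'a pair_pre_digraph" where
  "graph_complement G =
     \<lparr>pverts = pverts G,
      parcs = {(u, v). u \<in> pverts G \<and> v \<in> pverts G \<and> u \<noteq> v \<and> (u, v) \<notin> parcs G}\<rparr>"

text \<open>
  Every finite graph is isomorphic to one with vertices in \<^typ>\<open>nat\<close>; ``exactly once'' is
  meant up to isomorphism.
\<close>

definition enumerates_finite_graphs :: "(nat \<Rightarrow> nat pair_pre_digraph) \<Rightarrow> bool" where
  "enumerates_finite_graphs G \<longleftrightarrow>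
     (\<forall>n. pair_graph (G n)) \<and>
     (\<forall>F :: nat pair_pre_digraph. pair_graph F \<longrightarrow>
        (\<exists>!n. digraph_iso (with_proj F) (with_proj (G n))))"

definition c_lambda ::
    "(nat \<Rightarrow> nat pair_pre_digraph) \<Rightarrow> real \<Rightarrow> 'a pair_pre_digraph \<Rightarrow> 'b pair_pre_digraph \<Rightarrow> ereal" where
  "c_lambda G lam H1 H2 =
     liminf (\<lambda>n. ereal (lam * hom_density H1 (G n)
                        + (2 - lam) * hom_density H2 (graph_complement (G n))))"

definition balanced_ramsey_multiplicity_constant ::
    "(nat \<Rightarrow> nat pair_pre_digraph) \<Rightarrow> 'a pair_pre_digraph \<Rightarrow> 'b pair_pre_digraph \<Rightarrow> ereal" where
  "balanced_ramsey_multiplicity_constant G H1 H2 = (SUP lam\<in>{0..2}. c_lambda G lam H1 H2)"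

definition ramsey_multiplicity_constant ::
    "(nat \<Rightarrow> nat pair_pre_digraph) \<Rightarrow> 'a pair_pre_digraph \<Rightarrow> ereal" where
  "ramsey_multiplicity_constant G H =
     liminf (\<lambda>n. ereal (hom_density H (G n) + hom_density H (graph_complement (G n))))"

lemma pair_graph_graph_complement:
  assumes "pair_graph G"
  shows "pair_graph (graph_complement G)"
proof -
  interpret pair_graph G by fact
  have "finite (parcs (graph_complement G))"
    by (rule finite_subset[of _ "pverts G \<times> pverts G"])
       (auto simp: graph_complement_def pair_finite_verts)
  moreover have "(v, u) \<in> parcs G" if "(u, v) \<in> parcs G" for u v
    using that pair_sym_arcs by (auto simp: symmetric_def dest: symD)
  ultimately show ?thesis
    by unfold_locales
       (auto simp: graph_complement_def pair_finite_verts symmetric_def intro!: symI)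
qed

lemma digraph_iso_with_proj_iff:
  assumes "pair_graph F" "pair_graph G"
  shows "digraph_iso (with_proj F) (with_proj G) \<longleftrightarrow>
    (\<exists>f. bij_betw f (pverts F) (pverts G) \<and>
         (\<forall>u\<in>pverts F. \<forall>v\<in>pverts F. (u, v) \<in> parcs F \<longleftrightarrow> (f u, f v) \<in> parcs G))"
    (is "?L \<longleftrightarrow> ?R")
proof
  interpret F: pair_graph F by fact
  assume ?L
  then obtain h where h: "pre_digraph.digraph_isomorphism (with_proj F) h"
    and G: "with_proj G = app_iso h (with_proj F)"
    by (auto simp: digraph_iso_def)
  from G have eqs: "pverts G = iso_verts h ` pverts F" "parcs G = iso_arcs h ` parcs F"
    "iso_tail h = fst" "iso_head h = snd"
    by (auto simp: with_proj_def app_iso_def)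
  from h have inj: "inj_on (iso_verts h) (pverts F)"
    and arc: "\<forall>a\<in>parcs F. iso_verts h (fst a) = fst (iso_arcs h a)
                          \<and> iso_verts h (snd a) = snd (iso_arcs h a)"
    by (auto simp: F.digraph_isomorphism_def eqs)
  have arc': "iso_arcs h (u, v) = (iso_verts h u, iso_verts h v)" if "(u, v) \<in> parcs F" for u v
    using arc that by (metis fst_conv snd_conv prod.collapse)
  show ?R
  proof (intro exI conjI ballI iffI)
    show "bij_betw (iso_verts h) (pverts F) (pverts G)"
      using inj eqs by (simp add: bij_betw_def)
  next
    fix u v assume "(u, v) \<in> parcs F"
    then show "(iso_verts h u, iso_verts h v) \<in> parcs G"
      using arc' eqs by force
  next
    fix u v
    assume uv: "u \<in> pverts F" "v \<in> pverts F" and "(iso_verts h u, iso_verts h v) \<in> parcs G"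
    then obtain x y where xy: "(x, y) \<in> parcs F"
      "(iso_verts h u, iso_verts h v) = (iso_verts h x, iso_verts h y)"
      using arc' eqs by (metis (no_types, lifting) imageE surj_pair)
    then have "x = u" "y = v"
      using inj uv F.in_arcsD1[OF xy(1)] F.in_arcsD2[OF xy(1)] by (auto dest: inj_onD)
    with xy show "(u, v) \<in> parcs F" by simp
  qed
next
  interpret F: pair_graph F by fact
  interpret G: pair_graph G by fact
  assume ?R
  then obtain f where f: "bij_betw f (pverts F) (pverts G)"
    and arc: "\<And>u v. u \<in> pverts F \<Longrightarrow> v \<in> pverts F \<Longrightarrow>
                (u, v) \<in> parcs F \<longleftrightarrow> (f u, f v) \<in> parcs G"
    by blast
  let ?h = "\<lparr>iso_verts = f, iso_arcs = map_prod f f, iso_head = snd, iso_tail = fst\<rparr>"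
  have inj: "inj_on f (pverts F)" and img: "f ` pverts F = pverts G"
    using f by (auto simp: bij_betw_def)
  have "parcs F \<subseteq> pverts F \<times> pverts F"
    using F.in_arcsD1 F.in_arcsD2 by auto
  then have "inj_on (map_prod f f) (parcs F)"
    using map_prod_inj_on[OF inj inj] inj_on_subset by blast
  then have iso: "F.digraph_isomorphism ?h"
    using inj F.wf_digraph_axioms by (simp add: F.digraph_isomorphism_def)
  have "parcs G = map_prod f f ` parcs F"
  proof (intro equalityI subsetI)
    fix e assume e: "e \<in> parcs G"
    obtain x y where xy: "e = (x, y)" by (cases e)
    with e have "x \<in> f ` pverts F" "y \<in> f ` pverts F"
      using G.in_arcsD1 G.in_arcsD2 img by auto
    then obtain u v where "u \<in> pverts F" "v \<in> pverts F" "x = f u" "y = f v" by blast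
    then show "e \<in> map_prod f f ` parcs F"
      using arc e xy by force
  next
    fix e assume "e \<in> map_prod f f ` parcs F"
    then obtain u v where "(u, v) \<in> parcs F" "e = (f u, f v)" by auto
    then show "e \<in> parcs G"
      using arc F.in_arcsD1 F.in_arcsD2 by blast
  qed
  then have "with_proj G = app_iso ?h (with_proj F)"
    using img by (simp add: app_iso_def with_proj_def)
  with iso show ?L by (auto simp: digraph_iso_def)
qed

lemma ex_enumerates_finite_graphs: "\<exists>G. enumerates_finite_graphs G"
proof -
  define S :: "nat pair_pre_digraph set" where "S = {F. pair_graph F}"
  define cls where
    "cls F = {F' \<in> S. digraph_iso (with_proj F) (with_proj F')}" for F :: "nat pair_pre_digraph"
  have refl: "F \<in> cls F" if "F \<in> S" for F
    using that by (auto simp: cls_def S_def digraph_iso_with_proj_iff intro!: exI[of _ id])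
  have sym: "digraph_iso (with_proj F') (with_proj F)"
    if "F \<in> S" "digraph_iso (with_proj F) (with_proj F')" for F F'
  proof -
    interpret pair_graph F using that by (simp add: S_def)
    show ?thesis by (rule digraph_iso_swap[OF wf_digraph_axioms that(2)])
  qed
  have cls_eq: "cls F = cls F'"
    if "F \<in> S" "F' \<in> S" "digraph_iso (with_proj F) (with_proj F')" for F F'
    using that sym[OF that(1,3)] by (auto simp: cls_def intro: digraph_iso_trans)
  have "countable S"
  proof (rule countableI')
    show "inj_on (\<lambda>F. (to_nat_on {A :: nat set. finite A} (pverts F),
                   to_nat_on {A :: (nat \<times> nat) set. finite A} (parcs F))) S"
    proof (rule inj_onI)
      fix F F' assume FS: "F \<in> S" "F' \<in> S" and
        eq: "(to_nat_on {A :: nat set. finite A} (pverts F),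
                   to_nat_on {A :: (nat \<times> nat) set. finite A} (parcs F)) =
             (to_nat_on {A :: nat set. finite A} (pverts F'),
                   to_nat_on {A :: (nat \<times> nat) set. finite A} (parcs F'))"
      have fin: "finite (pverts X) \<and> finite (parcs X)" if "X \<in> S" for X
      proof -
        interpret pair_graph X using that by (simp add: S_def)
        show ?thesis using pair_finite_verts pair_finite_arcs by simp
      qed
      have cA: "countable {A :: nat set. finite A}" "countable {A :: (nat \<times> nat) set. finite A}"
        using countable_Collect_finite by auto
      have "pverts F = pverts F'" "parcs F = parcs F'"
        using eq fin[OF FS(1)] fin[OF FS(2)] cA by auto
      then show "F = F'" by simp
    qed
  qed
  then have cC: "countable (cls ` S)" by simp
  have iC: "infinite (cls ` S)"
  proof -
    define E :: "nat \<Rightarrow> nat pair_pre_digraph" where "E n = \<lparr>pverts = {..<n}, parcs = {}\<rparr>" for n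
    have ES: "E n \<in> S" for n
      unfolding S_def mem_Collect_eq by unfold_locales (auto simp: E_def symmetric_def sym_def)
    have "inj (\<lambda>n. cls (E n))"
    proof (rule injI)
      fix m n assume "cls (E m) = cls (E n)"
      then have "digraph_iso (with_proj (E m)) (with_proj (E n))"
        using refl[OF ES] by (auto simp: cls_def)
      then obtain f where "bij_betw f (pverts (E m)) (pverts (E n))"
        using ES by (auto simp: S_def digraph_iso_with_proj_iff)
      then have "card (pverts (E m)) = card (pverts (E n))" by (rule bij_betw_same_card)
      then show "m = n" by (simp add: E_def)
    qed
    then have "infinite (range (\<lambda>n. cls (E n)))" by (rule range_inj_infinite)
    moreover have "range (\<lambda>n. cls (E n)) \<subseteq> cls ` S" using ES by auto
    ultimately show ?thesis using finite_subset by blast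
  qed
  define c where "c = from_nat_into (cls ` S)"
  have c: "bij_betw c UNIV (cls ` S)"
    unfolding c_def by (rule bij_betw_from_nat_into[OF cC iC])
  have "\<forall>n. \<exists>F. F \<in> S \<and> c n = cls F"
    using c by (metis bij_betwE imageE UNIV_I)
  then obtain G where GS: "\<And>n. G n \<in> S" and cG: "\<And>n. c n = cls (G n)"
    by metis
  have "enumerates_finite_graphs G"
    unfolding enumerates_finite_graphs_def
  proof (intro conjI allI impI)
    show "pair_graph (G n)" for n using GS by (simp add: S_def)
  next
    fix F :: "nat pair_pre_digraph" assume "pair_graph F"
    then have F: "F \<in> S" by (simp add: S_def)
    then obtain n where n: "c n = cls F"
      using c by (metis bij_betw_imp_surj_on imageE imageI)
    show "\<exists>!n. digraph_iso (with_proj F) (with_proj (G n))"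
    proof (rule ex1I)
      have "G n \<in> cls F" using n cG refl[OF GS] by metis
      then show "digraph_iso (with_proj F) (with_proj (G n))" by (simp add: cls_def)
    next
      fix m assume "digraph_iso (with_proj F) (with_proj (G m))"
      then have "c m = c n" using cls_eq[OF F GS] n cG by simp
      then show "m = n" using c by (auto simp: bij_betw_def dest: injD)
    qed
  qed
  then show ?thesis by blast
qed

end

theory Submission
  imports Defs
begin

text \<open>
  At \<open>\<lambda> = 1\<close> the balanced quantity is \<open>c(H)\<close>, so only \<open>c\<^sub>\<lambda>(H, H) \<le> c(H)\<close> is at stake.
  Complementation permutes the isomorphism classes of graphs, and it swaps the two densities;
  so if \<open>\<lambda> t(H, G) + (2 - \<lambda>) t(H, co G) > C\<close> for all but finitely many \<open>G\<close>, the same holds with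
  \<open>G\<close> and \<open>co G\<close> exchanged.  Averaging the two inequalities eliminates \<open>\<lambda>\<close>.
\<close>

lemma finite_graph_homs:
  assumes "pair_graph H" "pair_graph G"
  shows "finite (graph_homs H G)"
proof -
  interpret H: pair_graph H by fact
  interpret G: pair_graph G by fact
  have "finite (pverts H \<rightarrow>\<^sub>E pverts G)"
    by (intro finite_PiE H.pair_finite_verts G.pair_finite_verts)
  then show ?thesis
    by (rule rev_finite_subset) (auto simp: graph_homs_def)
qed

text \<open>Composing with an isomorphism embeds the homomorphisms into \<open>F\<close> in those
  into \<open>G\<close>. One inequality suffices, since the isomorphism relation is
  symmetric.\<close>

lemma card_graph_homs_le:
  assumes H: "pair_graph H" and F: "pair_graph F" and G: "pair_graph G"
    and iso: "digraph_iso (with_proj F) (with_proj G)"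
  shows "card (graph_homs H F) \<le> card (graph_homs H G)"
proof -
  interpret H: pair_graph H by fact
  obtain f where f: "bij_betw f (pverts F) (pverts G)"
    and arc: "\<And>u v. u \<in> pverts F \<Longrightarrow> v \<in> pverts F \<Longrightarrow>
                (u, v) \<in> parcs F \<longleftrightarrow> (f u, f v) \<in> parcs G"
    using iso digraph_iso_with_proj_iff[OF F G] by blast
  \<comment> \<open>Members of \<open>graph_homs\<close> are extensional, so the composite is
    restricted to \<open>pverts H\<close>.\<close>
  let ?c = "\<lambda>g. \<lambda>x\<in>pverts H. f (g x)"
  have "inj_on ?c (graph_homs H F)"
  proof (rule inj_onI)
    fix g h
    assume gh: "g \<in> graph_homs H F" "h \<in> graph_homs H F" and eq: "?c g = ?c h"
    then have g: "g \<in> pverts H \<rightarrow>\<^sub>E pverts F" and h: "h \<in> pverts H \<rightarrow>\<^sub>E pverts F"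
      by (auto simp: graph_homs_def)
    show "g = h"
    proof (rule PiE_ext[OF g h])
      fix x assume x: "x \<in> pverts H"
      then have "f (g x) = f (h x)"
        using fun_cong[OF eq, of x] by simp
      then show "g x = h x"
        using f g h x by (auto simp: bij_betw_def dest!: inj_onD)
    qed
  qed
  moreover have "?c ` graph_homs H F \<subseteq> graph_homs H G"
  proof (rule image_subsetI)
    fix g assume g: "g \<in> graph_homs H F"
    have gV: "g x \<in> pverts F" if "x \<in> pverts H" for x
      using g that by (auto simp: graph_homs_def)
    have "f (g x) \<in> pverts G" if "x \<in> pverts H" for x
      using bij_betwE[OF f] gV[OF that] by blast
    moreover have "(?c g u, ?c g v) \<in> parcs G" if "(u, v) \<in> parcs H" for u v
    proof -
      have uv: "u \<in> pverts H" "v \<in> pverts H"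
        using H.in_arcsD1[OF that] H.in_arcsD2[OF that] by auto
      have "(g u, g v) \<in> parcs F"
        using g that by (auto simp: graph_homs_def)
      with uv show ?thesis
        using arc[OF gV gV] by simp
    qed
    ultimately show "?c g \<in> graph_homs H G"
      unfolding graph_homs_def mem_Collect_eq by (intro conjI restrict_PiE_iff[THEN iffD2]) blast+
  qed
  ultimately show ?thesis
    by (rule card_inj_on_le) (rule finite_graph_homs[OF H G])
qed

lemma digraph_iso_with_proj_sym:
  assumes "pair_graph F" "digraph_iso (with_proj F) (with_proj G)"
  shows "digraph_iso (with_proj G) (with_proj F)"
proof -
  interpret pair_graph F by fact
  show ?thesis by (rule digraph_iso_swap[OF wf_digraph_axioms assms(2)])
qed

lemma hom_density_iso:
  assumes H: "pair_graph H" and F: "pair_graph F" and G: "pair_graph G"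
    and iso: "digraph_iso (with_proj F) (with_proj G)"
  shows "hom_density H F = hom_density H G"
proof -
  have "card (graph_homs H F) = card (graph_homs H G)"
    using card_graph_homs_le[OF H F G iso]
      card_graph_homs_le[OF H G F digraph_iso_with_proj_sym[OF F iso]] by simp
  moreover have "card (pverts F) = card (pverts G)"
    using iso digraph_iso_with_proj_iff[OF F G] bij_betw_same_card by blast
  ultimately show ?thesis
    by (simp add: hom_density_def)
qed

text \<open>This is an equality and not just an isomorphism: all arcs of \<open>G\<close> join
  distinct vertices of \<open>G\<close>, so negating adjacency twice restores exactly
  \<open>parcs G\<close>.\<close>

lemma graph_complement_graph_complement:
  assumes "pair_graph G"
  shows "graph_complement (graph_complement G) = G"
proof -
  interpret pair_graph G by fact
  have "parcs (graph_complement (graph_complement G)) = parcs G"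
    using in_arcsD1 in_arcsD2 no_loops by (fastforce simp: graph_complement_def)
  then show ?thesis
    by (simp add: graph_complement_def)
qed

text \<open>The same vertex bijection works: it preserves and reflects arcs, hence also non-arcs,
  and its injectivity handles the condition \<open>u \<noteq> v\<close>.\<close>

lemma digraph_iso_graph_complement:
  assumes F: "pair_graph F" and G: "pair_graph G"
    and iso: "digraph_iso (with_proj F) (with_proj G)"
  shows "digraph_iso (with_proj (graph_complement F)) (with_proj (graph_complement G))"
proof -
  obtain f where f: "bij_betw f (pverts F) (pverts G)"
    and arc: "\<And>u v. u \<in> pverts F \<Longrightarrow> v \<in> pverts F \<Longrightarrow>
                (u, v) \<in> parcs F \<longleftrightarrow> (f u, f v) \<in> parcs G"
    using iso digraph_iso_with_proj_iff[OF F G] by blast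
  have "f u \<in> pverts G" if "u \<in> pverts F" for u
    using bij_betwE[OF f] that by blast
  moreover have "f u = f v \<longleftrightarrow> u = v" if "u \<in> pverts F" "v \<in> pverts F" for u v
    using f that by (auto simp: bij_betw_def dest: inj_onD)
  ultimately have "\<forall>u\<in>pverts (graph_complement F). \<forall>v\<in>pverts (graph_complement F).
      (u, v) \<in> parcs (graph_complement F) \<longleftrightarrow> (f u, f v) \<in> parcs (graph_complement G)"
    using arc by (simp add: graph_complement_def)
  moreover have "bij_betw f (pverts (graph_complement F)) (pverts (graph_complement G))"
    using f by (simp add: graph_complement_def)
  ultimately show ?thesis
    using digraph_iso_with_proj_iff[OF F[THEN pair_graph_graph_complement]
        G[THEN pair_graph_graph_complement]] by blast
qed

text \<open>Complementation acts on isomorphism classes, hence on indices: \<open>p n\<close> is the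
  index of the representative of the complement of \<open>G n\<close>.\<close>

lemma enumerates_finite_graphs_complement:
  assumes G: "enumerates_finite_graphs G"
  obtains p where "\<And>n. p (p n) = n"
    and "\<And>n. digraph_iso (with_proj (graph_complement (G n))) (with_proj (G (p n)))"
proof -
  have pg: "pair_graph (G n)" for n
    using G by (simp add: enumerates_finite_graphs_def)
  note pgc = pg[THEN pair_graph_graph_complement]
  have uniq: "\<exists>!m. digraph_iso (with_proj (graph_complement (G n))) (with_proj (G m))" for n
    using G pgc by (simp add: enumerates_finite_graphs_def)
  then obtain p
    where p: "\<And>n. digraph_iso (with_proj (graph_complement (G n))) (with_proj (G (p n)))"
    by metis
  have "p (p n) = n" for n
  proof -
    have "digraph_iso (with_proj (G (p n))) (with_proj (graph_complement (G n)))"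
      by (rule digraph_iso_with_proj_sym[OF pgc p])
    from digraph_iso_graph_complement[OF pg pgc this]
    have "digraph_iso (with_proj (graph_complement (G (p n)))) (with_proj (G n))"
      by (simp add: graph_complement_graph_complement[OF pg])
    \<comment> \<open>Both \<open>p (p n)\<close> and \<open>n\<close> index a graph isomorphic to
      the complement of \<open>G (p n)\<close>, and there is only one such index.\<close>
    with p uniq show ?thesis by blast
  qed
  with p that show thesis by blast
qed

lemma c_lambda_le_ramsey_multiplicity_constant:
  assumes G: "enumerates_finite_graphs G" and H: "pair_graph H"
  shows "c_lambda G lam H H \<le> ramsey_multiplicity_constant G H"
proof -
  define a where "a n = hom_density H (G n)" for n
  define b where "b n = hom_density H (graph_complement (G n))" for n
  define x where "x n = lam * a n + (2 - lam) * b n" for n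
  have pg: "pair_graph (G n)" for n
    using G by (simp add: enumerates_finite_graphs_def)
  note pgc = pg[THEN pair_graph_graph_complement]
  obtain p where pp: "\<And>n. p (p n) = n"
    and p: "\<And>n. digraph_iso (with_proj (graph_complement (G n))) (with_proj (G (p n)))"
    using enumerates_finite_graphs_complement[OF G] by blast
  have ap: "a (p n) = b n" for n
    unfolding a_def b_def by (rule hom_density_iso[OF H pgc pg p, symmetric])
  have bp: "b (p n) = a n" for n
    using ap[of "p n"] pp by simp
  have inj: "inj p"
    by (metis injI pp)
  have "liminf (\<lambda>n. ereal (x n)) \<le> liminf (\<lambda>n. ereal (a n + b n))"
    \<comment> \<open>It suffices that each \<open>C\<close> strictly below the left side is
      eventually exceeded by \<open>a n + b n\<close>.\<close>
    unfolding le_Liminf_iff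
  proof (intro allI impI)
    fix C assume "C < liminf (\<lambda>n. ereal (x n))"
    then have ev: "\<forall>\<^sub>F n in sequentially. C < ereal (x n)"
      by (rule less_LiminfD)
    \<comment> \<open>Eventually means with finitely many exceptions, and the preimage of a finite
      set under the injective \<open>p\<close> is finite.\<close>
    then have "\<forall>\<^sub>F n in sequentially. C < ereal (x (p n))"
      using MOST_inj[OF _ inj] unfolding cofinite_eq_sequentially by blast
    with ev show "\<forall>\<^sub>F n in sequentially. C < ereal (a n + b n)"
    proof eventually_elim
      case (elim n)
      \<comment> \<open>Passing to \<open>p n\<close> swaps \<open>a\<close> and \<open>b\<close>,
        so each receives the total weight \<open>lam + (2 - lam) = 2\<close>.\<close>
      have "x n + x (p n) = 2 * (a n + b n)"
        by (simp add: x_def ap bp algebra_simps)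
      then show ?case
        \<comment> \<open>For real \<open>C\<close>, both summands exceed \<open>C\<close>, so
          \<open>a n + b n > C\<close>; the infinite values of \<open>C\<close> are trivial.\<close>
        using elim by (cases C) auto
    qed
  qed
  then show ?thesis
    by (simp add: c_lambda_def ramsey_multiplicity_constant_def x_def a_def b_def)
qed

theorem theorem1p7:
  fixes G :: "nat \<Rightarrow> nat pair_pre_digraph"
    and H :: "'a pair_pre_digraph"
  assumes "enumerates_finite_graphs G"
    and "pair_graph H"
  shows "balanced_ramsey_multiplicity_constant G H H = ramsey_multiplicity_constant G H"
proof (rule antisym)
  show "balanced_ramsey_multiplicity_constant G H H \<le> ramsey_multiplicity_constant G H"
    unfolding balanced_ramsey_multiplicity_constant_def
    by (intro SUP_least c_lambda_le_ramsey_multiplicity_constant assms)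
  have "ramsey_multiplicity_constant G H = c_lambda G 1 H H"
    by (simp add: c_lambda_def ramsey_multiplicity_constant_def)
  also have "\<dots> \<le> balanced_ramsey_multiplicity_constant G H H"
    unfolding balanced_ramsey_multiplicity_constant_def by (rule SUP_upper) simp
  finally show "ramsey_multiplicity_constant G H \<le> balanced_ramsey_multiplicity_constant G H H" .
qed

end
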